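(* Let $(H;(\cdot,\cdot))$ be an inner product space over $\mathbb{K}$ ($\mathbb{K}=\mathbb{R}$ or $\mathbb{C}$), let $n\ge 1$, and let $x,y_1,\dots,y_n\in H$. Then all three of the following inequalities hold: (i) $$\sum_{i=1}^{n}|(x,y_i)|^2\le \|x\|\,\max_{1\le i\le n}|(x,y_i)|\,\Big(\sum_{i,j=1}^{n}|(y_i,y_j)|\Big)^{1/2};$$ (ii) for all real $p>1$ and $q$ with $\frac1p+\frac1q=1$, $$\sum_{i=1}^{n}|(x,y_i)|^2\le \|x\|\,\Big(\sum_{i=1}^{n}|(x,y_i)|^p\Big)^{1/p}\Big(\sum_{i,j=1}^{n}|(y_i,y_j)|^q\Big)^{1/(2q)};$$ (iii) $$\sum_{i=1}^{n}|(x,y_i)|^2\le \|x\|\,\sum_{i=1}^{n}|(x,y_i)|\;\max_{1\le i,j\le n}|(y_i,y_j)|^{1/2}.$$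
   Context: The inner product is linear in the first argument and conjugate-linear in the second; $\|x\|=(x,x)^{1/2}$. Completeness of $H$ is not assumed. *)

theory Defs
  imports "HOL-Analysis.Inner_Product"
begin

text \<open>
  Real inner product spaces are the library class \<^class>\<open>real_inner\<close>. The locale below is the
  counterpart over the complex numbers, without completeness. Hermitian symmetry makes
  \<open>cinner x x\<close> real, so positivity and the norm only need its real part.
\<close>

locale complex_inner_product_space = vector_space scaleC
  for scaleC :: "complex \<Rightarrow> 'a::ab_group_add \<Rightarrow> 'a" +
  fixes cinner :: "'a \<Rightarrow> 'a \<Rightarrow> complex"
  assumes cinner_commute: "cinner x y = cnj (cinner y x)"
    and cinner_add_left: "cinner (x + y) z = cinner x z + cinner y z"
    and cinner_scaleC_left: "cinner (scaleC c x) y = c * cinner x y"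
    and cinner_ge_zero: "0 \<le> Re (cinner x x)"
    and cinner_eq_zero_iff: "cinner x x = 0 \<longleftrightarrow> x = 0"

definition cinner_norm :: "('a \<Rightarrow> 'a \<Rightarrow> complex) \<Rightarrow> 'a \<Rightarrow> real"
  where "cinner_norm cinner x = sqrt (Re (cinner x x))"

lemma complex_inner_product_space_complex:
  "complex_inner_product_space (*) (\<lambda>z w. z * cnj w)"
  by unfold_locales (auto simp: algebra_simps)

end

theory Submission
  imports Defs "HOL-Analysis.Convex"
begin

text \<open>
  Put \<open>c\<^sub>i = (x, y\<^sub>i)\<close> and \<open>z = \<Sum>\<^sub>i c\<^sub>i y\<^sub>i\<close>. Then \<open>(x, z) = \<Sum>\<^sub>i |c\<^sub>i|\<^sup>2\<close>, so the Cauchy--Schwarz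
  inequality gives \<open>(\<Sum>\<^sub>i |c\<^sub>i|\<^sup>2)\<^sup>2 \<le> \<parallel>x\<parallel>\<^sup>2 \<Sum>\<^sub>i\<^sub>,\<^sub>j |c\<^sub>i| |c\<^sub>j| |(y\<^sub>i, y\<^sub>j)|\<close>. The three inequalities
  are the three Hoelder bounds (exponents \<open>(\<infinity>, 1)\<close>, \<open>(p, q)\<close> and \<open>(1, \<infinity>)\<close>) of the last double sum.
\<close>

text \<open>Dividing \<open>f\<close> by its p-norm and \<open>g\<close> by its q-norm lets Young's
  inequality be applied termwise; the normalised sums then add up to 1/p + 1/q = 1. If one of the
  norms is zero, that family vanishes on \<open>A\<close> and both sides are zero.\<close>

lemma Holder_sum:
  fixes f g :: "'i \<Rightarrow> real"
  assumes "finite A" "p > 1" "1 / p + 1 / q = 1"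
    and f: "\<And>i. i \<in> A \<Longrightarrow> 0 \<le> f i" and g: "\<And>i. i \<in> A \<Longrightarrow> 0 \<le> g i"
  shows "(\<Sum>i\<in>A. f i * g i) \<le> (\<Sum>i\<in>A. f i powr p) powr (1 / p) * (\<Sum>i\<in>A. g i powr q) powr (1 / q)"
proof -
  define F where "F = (\<Sum>i\<in>A. f i powr p)"
  define G where "G = (\<Sum>i\<in>A. g i powr q)"
  \<comment> \<open>The value \<open>q = 0\<close>, for which \<open>1 / q\<close> would be 0, is
    excluded here: 1/p < 1 forces 1/q > 0.\<close>
  have "0 < 1 / p" "1 / p < 1" using \<open>p > 1\<close> by simp_all
  then have "0 < 1 / q" "1 / q < 1" using assms(3) by linarith+
  then have "q > 1" by (simp add: divide_less_eq split: if_splits)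
  have "F \<ge> 0" "G \<ge> 0" by (auto simp: F_def G_def intro!: sum_nonneg)
  consider "F = 0" | "G = 0" | "F > 0" "G > 0"
    using \<open>F \<ge> 0\<close> \<open>G \<ge> 0\<close> by linarith
  then show ?thesis
  proof cases
    case 1
    then have "\<forall>i\<in>A. f i = 0"
      using \<open>finite A\<close> by (simp add: F_def sum_nonneg_eq_0_iff)
    then show ?thesis by simp
  next
    case 2
    then have "\<forall>i\<in>A. g i = 0"
      using \<open>finite A\<close> by (simp add: G_def sum_nonneg_eq_0_iff)
    then show ?thesis by simp
  next
    case 3
    define u where "u = F powr (1 / p)"
    define v where "v = G powr (1 / q)"
    have uv: "u > 0" "v > 0" using 3 by (auto simp: u_def v_def)
    have up: "u powr p = F" "v powr q = G"
      using 3 \<open>p > 1\<close> \<open>q > 1\<close> by (auto simp: u_def v_def powr_powr)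
    have "(\<Sum>i\<in>A. (f i / u) * (g i / v))
        \<le> (\<Sum>i\<in>A. (f i / u) powr p / p + (g i / v) powr q / q)"
      using f g uv \<open>p > 1\<close> \<open>q > 1\<close> assms(3)
      by (intro sum_mono Youngs_inequality) auto
    also have "\<dots> = (\<Sum>i\<in>A. f i powr p / (F * p) + g i powr q / (G * q))"
      using f g uv by (intro sum.cong) (auto simp: powr_divide up)
    also have "\<dots> = F / (F * p) + G / (G * q)"
      by (simp add: sum.distrib F_def G_def flip: sum_divide_distrib)
    also have "\<dots> = 1" using 3 assms(3) by simp
    finally have "(\<Sum>i\<in>A. f i * g i) / (u * v) \<le> 1"
      by (simp add: sum_divide_distrib)
    then have "(\<Sum>i\<in>A. f i * g i) \<le> u * v" using uv by (simp add: field_simps)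
    then show ?thesis by (simp add: u_def v_def F_def G_def)
  qed
qed

text \<open>Here \<open>a i\<close> stands for |(x, y_i)|, \<open>b i j\<close> for |(y_i, y_j)| and
  \<open>N\<close> for the norm of x. The inner product enters only through
  \<open>form_bound\<close>, so the real and the complex case share the three estimates
  below.\<close>

context
  fixes I :: "'i set" and a :: "'i \<Rightarrow> real" and b :: "'i \<Rightarrow> 'i \<Rightarrow> real" and N :: real
  assumes fin: "finite I" and a_nonneg: "\<And>i. 0 \<le> a i"
    and b_nonneg: "\<And>i j. 0 \<le> b i j" and N_nonneg: "0 \<le> N"
    and form_bound: "(\<Sum>i\<in>I. (a i)\<^sup>2)\<^sup>2 \<le> N\<^sup>2 * (\<Sum>i\<in>I. \<Sum>j\<in>I. a i * a j * b i j)"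
begin

text \<open>Taking square roots in \<open>form_bound\<close> leaves one task for each of the three
  inequalities: to bound the double sum by a perfect square.\<close>

lemma sum_squares_le:
  assumes "(\<Sum>i\<in>I. \<Sum>j\<in>I. a i * a j * b i j) \<le> B\<^sup>2" "0 \<le> B"
  shows "(\<Sum>i\<in>I. (a i)\<^sup>2) \<le> N * B"
proof (rule power2_le_imp_le)
  show "(\<Sum>i\<in>I. (a i)\<^sup>2)\<^sup>2 \<le> (N * B)\<^sup>2"
    using form_bound mult_left_mono[OF assms(1), of "N\<^sup>2"] by (simp add: power_mult_distrib)
  show "0 \<le> N * B" using N_nonneg assms(2) by simp
qed

text \<open>Exponents (\<infinity>, 1): each product \<open>a i * a j\<close> is at most the square
  of the maximum, which then leaves the sum.\<close>

lemma sum_squares_le_Max: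
  assumes "I \<noteq> {}"
  shows "(\<Sum>i\<in>I. (a i)\<^sup>2) \<le> N * (MAX i\<in>I. a i) * sqrt (\<Sum>i\<in>I. \<Sum>j\<in>I. b i j)"
proof -
  define M where "M = (MAX i\<in>I. a i)"
  have aM: "a i \<le> M" if "i \<in> I" for i using that fin by (simp add: M_def)
  have M: "0 \<le> M" using assms aM a_nonneg by (meson all_not_in_conv order_trans)
  have b_sum: "0 \<le> (\<Sum>i\<in>I. \<Sum>j\<in>I. b i j)" by (intro sum_nonneg b_nonneg)
  have "(\<Sum>i\<in>I. \<Sum>j\<in>I. a i * a j * b i j) \<le> (\<Sum>i\<in>I. \<Sum>j\<in>I. M * M * b i j)"
    by (intro sum_mono mult_mono aM a_nonneg b_nonneg mult_nonneg_nonneg M order_refl)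
  also have "\<dots> = (M * sqrt (\<Sum>i\<in>I. \<Sum>j\<in>I. b i j))\<^sup>2"
    using b_sum by (simp add: power_mult_distrib sum_distrib_left power2_eq_square[of M])
  finally show ?thesis
    using sum_squares_le[of "M * sqrt (\<Sum>i\<in>I. \<Sum>j\<in>I. b i j)"] M b_sum
    by (simp add: M_def mult.assoc)
qed

text \<open>H\<ouml>lder's inequality is applied once, over the index set
  \<open>I \<times> I\<close>, to the families \<open>a i * a j\<close> and
  \<open>b i j\<close>.\<close>

lemma sum_squares_le_powr:
  assumes "p > 1" "1 / p + 1 / q = 1"
  shows "(\<Sum>i\<in>I. (a i)\<^sup>2)
    \<le> N * (\<Sum>i\<in>I. a i powr p) powr (1 / p) * (\<Sum>i\<in>I. \<Sum>j\<in>I. b i j powr q) powr (1 / (2 * q))"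
proof -
  define P where "P = (\<Sum>i\<in>I. a i powr p)"
  define G where "G = (\<Sum>i\<in>I. \<Sum>j\<in>I. b i j powr q)"
  have "0 \<le> P" "0 \<le> G" by (auto simp: P_def G_def intro!: sum_nonneg)
  have "(\<Sum>i\<in>I. \<Sum>j\<in>I. a i * a j * b i j)
      = (\<Sum>s\<in>I \<times> I. (a (fst s) * a (snd s)) * b (fst s) (snd s))"
    by (simp add: sum.cartesian_product case_prod_unfold)
  also have "\<dots> \<le> (\<Sum>s\<in>I \<times> I. (a (fst s) * a (snd s)) powr p) powr (1 / p)
      * (\<Sum>s\<in>I \<times> I. b (fst s) (snd s) powr q) powr (1 / q)"
    using fin assms by (intro Holder_sum) (auto simp: a_nonneg b_nonneg)
  \<comment> \<open>The p-th power of a product factors, so the double sum is a product of two equal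
    single sums. This makes the first factor a square; halving the exponent of \<open>G\<close>
    makes the second one a square too, whence \<open>1 / (2 * q)\<close>.\<close>
  also have "(\<Sum>s\<in>I \<times> I. (a (fst s) * a (snd s)) powr p) = P * P"
    by (simp add: P_def sum_product sum.cartesian_product case_prod_unfold powr_mult a_nonneg)
  also have "(\<Sum>s\<in>I \<times> I. b (fst s) (snd s) powr q) = G"
    by (simp add: G_def sum.cartesian_product case_prod_unfold)
  also have "(P * P) powr (1 / p) * G powr (1 / q) = (P powr (1 / p) * G powr (1 / (2 * q)))\<^sup>2"
  proof -
    have "(P * P) powr (1 / p) = (P powr (1 / p))\<^sup>2"
      using \<open>0 \<le> P\<close> by (simp add: powr_mult power2_eq_square)
    moreover have "G powr (1 / q) = (G powr (1 / (2 * q)))\<^sup>2"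
      by (simp add: power2_eq_square flip: powr_add)
    ultimately show ?thesis by (simp only: power_mult_distrib)
  qed
  finally show ?thesis
    using sum_squares_le[of "P powr (1 / p) * G powr (1 / (2 * q))"]
    by (simp add: P_def G_def mult.assoc)
qed

text \<open>Exponents (1, \<infinity>): once \<open>b i j\<close> is replaced by its upper bound,
  the remaining double sum of \<open>a i * a j\<close> is the square of the sum of the
  \<open>a i\<close>.\<close>

lemma sum_squares_le_sum:
  assumes "I \<noteq> {}"
  shows "(\<Sum>i\<in>I. (a i)\<^sup>2) \<le> N * (\<Sum>i\<in>I. a i) * (MAX (i, j)\<in>I \<times> I. sqrt (b i j))"
proof -
  define M where "M = (MAX (i, j)\<in>I \<times> I. sqrt (b i j))"
  have sM: "sqrt (b i j) \<le> M" if "i \<in> I" "j \<in> I" for i j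
    unfolding M_def using that fin by (intro Max_ge) (auto intro!: image_eqI[of _ _ "(i, j)"])
  obtain k where "k \<in> I" using assms by auto
  have M: "0 \<le> M" using sM[OF \<open>k \<in> I\<close> \<open>k \<in> I\<close>] b_nonneg[of k k] by (meson order_trans real_sqrt_ge_zero)
  have bM: "b i j \<le> M\<^sup>2" if "i \<in> I" "j \<in> I" for i j
    using sM[OF that] by (rule sqrt_le_D)
  have "(\<Sum>i\<in>I. \<Sum>j\<in>I. a i * a j * b i j) \<le> (\<Sum>i\<in>I. \<Sum>j\<in>I. a i * a j * M\<^sup>2)"
    by (intro sum_mono mult_left_mono bM mult_nonneg_nonneg a_nonneg)
  also have "\<dots> = ((\<Sum>i\<in>I. a i) * M)\<^sup>2"
    by (simp add: power_mult_distrib power2_eq_square[of "sum a I"] sum_product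
        flip: sum_distrib_right)
  finally show ?thesis
    using sum_squares_le[of "(\<Sum>i\<in>I. a i) * M"] M
    by (simp add: M_def mult.assoc sum_nonneg a_nonneg)
qed

end

text \<open>This is \<open>form_bound\<close> for a real inner product, obtained from Cauchy-Schwarz
  for \<open>x\<close> and the combination \<open>z\<close> below; the terms of the expanded
  \<open>inner z z\<close> are bounded by their absolute values.\<close>

lemma inner_form_bound:
  fixes x :: "'a::real_inner"
  shows "(\<Sum>i\<in>I. \<bar>inner x (y i)\<bar>\<^sup>2)\<^sup>2
    \<le> (norm x)\<^sup>2 * (\<Sum>i\<in>I. \<Sum>j\<in>I. \<bar>inner x (y i)\<bar> * \<bar>inner x (y j)\<bar> * \<bar>inner (y i) (y j)\<bar>)"
proof -
  define z where "z = (\<Sum>i\<in>I. inner x (y i) *\<^sub>R y i)"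
  have "inner x z = (\<Sum>i\<in>I. \<bar>inner x (y i)\<bar>\<^sup>2)"
    by (simp add: z_def inner_sum_right power2_eq_square)
  then have "(\<Sum>i\<in>I. \<bar>inner x (y i)\<bar>\<^sup>2)\<^sup>2 \<le> (norm x)\<^sup>2 * inner z z"
    using Cauchy_Schwarz_ineq[of x z] by (simp add: power2_norm_eq_inner)
  moreover have "inner z z
      \<le> (\<Sum>i\<in>I. \<Sum>j\<in>I. \<bar>inner x (y i)\<bar> * \<bar>inner x (y j)\<bar> * \<bar>inner (y i) (y j)\<bar>)"
    unfolding z_def inner_sum_left inner_sum_right
    by (intro sum_mono) (simp add: abs_mult[symmetric] inner_commute mult_ac)
  ultimately show ?thesis
    by (meson mult_left_mono order_trans zero_le_power2)
qed

context complex_inner_product_space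
begin

lemma cinner_add_right: "cinner x (y + z) = cinner x y + cinner x z"
  by (metis cinner_commute cinner_add_left complex_cnj_add)

lemma cinner_scaleC_right: "cinner x (scaleC c y) = cnj c * cinner x y"
  by (metis cinner_commute cinner_scaleC_left complex_cnj_mult)

lemma cinner_zero_left: "cinner 0 x = 0"
  using cinner_add_left[of 0 0 x] by simp

lemma cinner_zero_right: "cinner x 0 = 0"
  using cinner_add_right[of x 0 0] by simp

lemma cinner_sum_left: "cinner (sum f I) x = (\<Sum>i\<in>I. cinner (f i) x)"
  by (induction I rule: infinite_finite_induct) (auto simp: cinner_zero_left cinner_add_left)

lemma cinner_sum_right: "cinner x (sum f I) = (\<Sum>i\<in>I. cinner x (f i))"
  by (induction I rule: infinite_finite_induct) (auto simp: cinner_zero_right cinner_add_right)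

text \<open>Hermitian symmetry with equal arguments makes the imaginary part its own
  negative.\<close>

lemma cinner_self: "cinner x x = of_real (Re (cinner x x))"
  using arg_cong[OF cinner_commute[of x x], of Im] by (simp add: complex_eq_iff)

lemma complex_Cauchy_Schwarz: "(cmod (cinner x y))\<^sup>2 \<le> Re (cinner x x) * Re (cinner y y)"
proof (cases "y = 0")
  case True
  then show ?thesis by (simp add: cinner_zero_right)
next
  case False
  define r where "r = Re (cinner y y)"
  define c where "c = cinner x y"
  \<comment> \<open>This choice makes \<open>x + scaleC t y\<close> orthogonal to \<open>y\<close>:
    the projection of \<open>x\<close> onto \<open>y\<close> is subtracted. Nonnegativity of the
    remaining squared norm is the claim.\<close>
  define t where "t = - c / of_real r"
  have yy: "cinner y y = of_real r" unfolding r_def by (rule cinner_self)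
  have r: "r > 0"
    using False yy cinner_eq_zero_iff[of y] cinner_ge_zero[of y] by (auto simp: r_def less_le)
  have yx: "cinner y x = cnj c" by (simp add: c_def cinner_commute[of y])
  have "cinner (x + scaleC t y) (x + scaleC t y)
      = cinner x x + cnj t * c + t * cnj c + t * cnj t * of_real r"
    by (simp add: cinner_add_left cinner_add_right cinner_scaleC_left cinner_scaleC_right
        yy yx algebra_simps flip: c_def)
  \<comment> \<open>Each cross term contributes -|c|^2/r and the quadratic term +|c|^2/r, so a
    single -|c|^2/r survives.\<close>
  also have "\<dots> = cinner x x - c * cnj c / of_real r"
    using r by (simp add: t_def field_simps)
  also have "\<dots> = cinner x x - of_real ((cmod c)\<^sup>2 / r)"
    by (simp add: complex_norm_square flip: of_real_power)
  finally have "0 \<le> Re (cinner x x) - (cmod c)\<^sup>2 / r"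
    using cinner_ge_zero[of "x + scaleC t y"] by simp
  then show ?thesis using r by (simp add: field_simps flip: c_def r_def)
qed

lemma cinner_form_bound:
  "(\<Sum>i\<in>I. (cmod (cinner x (y i)))\<^sup>2)\<^sup>2 \<le> (cinner_norm cinner x)\<^sup>2 *
    (\<Sum>i\<in>I. \<Sum>j\<in>I. cmod (cinner x (y i)) * cmod (cinner x (y j)) * cmod (cinner (y i) (y j)))"
proof -
  define S where "S = (\<Sum>i\<in>I. (cmod (cinner x (y i)))\<^sup>2)"
  define z where "z = (\<Sum>i\<in>I. scaleC (cinner x (y i)) (y i))"
  \<comment> \<open>Conjugate-linearity in the second argument turns each coefficient of
    \<open>z\<close> into its conjugate, so every term becomes a squared modulus.\<close>
  have "cinner x z = of_real S"
    by (simp add: z_def S_def cinner_sum_right cinner_scaleC_right complex_norm_square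
        mult.commute flip: of_real_power)
  then have "S\<^sup>2 \<le> (cinner_norm cinner x)\<^sup>2 * Re (cinner z z)"
    using complex_Cauchy_Schwarz[of x z] by (simp add: cinner_norm_def cinner_ge_zero)
  moreover have "cinner z z
      = (\<Sum>i\<in>I. \<Sum>j\<in>I. cinner x (y i) * cnj (cinner x (y j)) * cinner (y i) (y j))"
    by (subst sum.swap) (simp add: z_def cinner_sum_left cinner_sum_right cinner_scaleC_left
        cinner_scaleC_right sum_distrib_left mult_ac)
  \<comment> \<open>The terms may be complex; each real part is at most the modulus, in which the
    conjugation disappears.\<close>
  then have "Re (cinner z z)
      \<le> (\<Sum>i\<in>I. \<Sum>j\<in>I. cmod (cinner x (y i)) * cmod (cinner x (y j)) * cmod (cinner (y i) (y j)))"
    by (simp only: Re_sum) (intro sum_mono order_trans[OF complex_Re_le_cmod], simp add: norm_mult)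
  ultimately show ?thesis
    unfolding S_def by (meson mult_left_mono order_trans zero_le_power2)
qed

end

theorem theorem1:
  fixes n :: nat
  assumes "n \<ge> 1"
  shows
    "(\<forall>(x :: 'a::real_inner) (y :: nat \<Rightarrow> 'a).
        (\<Sum>i=1..n. \<bar>inner x (y i)\<bar>\<^sup>2)
          \<le> norm x * (MAX i\<in>{1..n}. \<bar>inner x (y i)\<bar>)
              * sqrt (\<Sum>i=1..n. \<Sum>j=1..n. \<bar>inner (y i) (y j)\<bar>)
      \<and> (\<forall>p q :: real. p > 1 \<and> 1 / p + 1 / q = 1 \<longrightarrow>
          (\<Sum>i=1..n. \<bar>inner x (y i)\<bar>\<^sup>2)
            \<le> norm x * (\<Sum>i=1..n. \<bar>inner x (y i)\<bar> powr p) powr (1 / p)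
                * (\<Sum>i=1..n. \<Sum>j=1..n. \<bar>inner (y i) (y j)\<bar> powr q) powr (1 / (2 * q)))
      \<and> (\<Sum>i=1..n. \<bar>inner x (y i)\<bar>\<^sup>2)
          \<le> norm x * (\<Sum>i=1..n. \<bar>inner x (y i)\<bar>)
              * (MAX (i, j)\<in>{1..n} \<times> {1..n}. sqrt \<bar>inner (y i) (y j)\<bar>))
    \<and>
     (\<forall>(scaleC :: complex \<Rightarrow> 'b::ab_group_add \<Rightarrow> 'b) (cinner :: 'b \<Rightarrow> 'b \<Rightarrow> complex)
        (x :: 'b) (y :: nat \<Rightarrow> 'b).
      complex_inner_product_space scaleC cinner \<longrightarrow>
        (\<Sum>i=1..n. (cmod (cinner x (y i)))\<^sup>2)
          \<le> cinner_norm cinner x * (MAX i\<in>{1..n}. cmod (cinner x (y i)))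
              * sqrt (\<Sum>i=1..n. \<Sum>j=1..n. cmod (cinner (y i) (y j)))
      \<and> (\<forall>p q :: real. p > 1 \<and> 1 / p + 1 / q = 1 \<longrightarrow>
          (\<Sum>i=1..n. (cmod (cinner x (y i)))\<^sup>2)
            \<le> cinner_norm cinner x * (\<Sum>i=1..n. cmod (cinner x (y i)) powr p) powr (1 / p)
                * (\<Sum>i=1..n. \<Sum>j=1..n. cmod (cinner (y i) (y j)) powr q) powr (1 / (2 * q)))
      \<and> (\<Sum>i=1..n. (cmod (cinner x (y i)))\<^sup>2)
          \<le> cinner_norm cinner x * (\<Sum>i=1..n. cmod (cinner x (y i)))
              * (MAX (i, j)\<in>{1..n} \<times> {1..n}. sqrt (cmod (cinner (y i) (y j)))))"
proof -
  \<comment> \<open>The hypothesis \<open>n \<ge> 1\<close> makes the index set nonempty, so that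
    the maxima in the first and third inequalities are taken over nonempty sets.\<close>
  have ne: "finite {1..n}" "{1..n} \<noteq> {}" using assms by auto
  show ?thesis
  proof (intro conjI allI impI)
    fix x :: 'a and y :: "nat \<Rightarrow> 'a"
    \<comment> \<open>These facts discharge the five context assumptions in order;
      \<open>abs_ge_zero\<close> occurs once for \<open>a\<close> and once for
      \<open>b\<close>.\<close>
    note bounds = ne(1) abs_ge_zero abs_ge_zero norm_ge_zero inner_form_bound[of x y "{1..n}"]
    show "(\<Sum>i=1..n. \<bar>inner x (y i)\<bar>\<^sup>2)
        \<le> norm x * (MAX i\<in>{1..n}. \<bar>inner x (y i)\<bar>)
            * sqrt (\<Sum>i=1..n. \<Sum>j=1..n. \<bar>inner (y i) (y j)\<bar>)"
      using sum_squares_le_Max[OF bounds ne(2)] .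
    show "(\<Sum>i=1..n. \<bar>inner x (y i)\<bar>\<^sup>2)
        \<le> norm x * (\<Sum>i=1..n. \<bar>inner x (y i)\<bar>)
            * (MAX (i, j)\<in>{1..n} \<times> {1..n}. sqrt \<bar>inner (y i) (y j)\<bar>)"
      using sum_squares_le_sum[OF bounds ne(2)] .
    fix p q :: real
    assume "p > 1 \<and> 1 / p + 1 / q = 1"
    then show "(\<Sum>i=1..n. \<bar>inner x (y i)\<bar>\<^sup>2)
        \<le> norm x * (\<Sum>i=1..n. \<bar>inner x (y i)\<bar> powr p) powr (1 / p)
            * (\<Sum>i=1..n. \<Sum>j=1..n. \<bar>inner (y i) (y j)\<bar> powr q) powr (1 / (2 * q))"
      using sum_squares_le_powr[OF bounds] by blast
  next
    fix scaleC :: "complex \<Rightarrow> 'b \<Rightarrow> 'b" and cinner :: "'b \<Rightarrow> 'b \<Rightarrow> complex"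
      and x :: 'b and y :: "nat \<Rightarrow> 'b"
    assume "complex_inner_product_space scaleC cinner"
    then interpret complex_inner_product_space scaleC cinner .
    have "0 \<le> cinner_norm cinner x" by (simp add: cinner_norm_def cinner_ge_zero)
    note bounds = ne(1) norm_ge_zero norm_ge_zero this cinner_form_bound[of x y "{1..n}"]
    show "(\<Sum>i=1..n. (cmod (cinner x (y i)))\<^sup>2)
        \<le> cinner_norm cinner x * (MAX i\<in>{1..n}. cmod (cinner x (y i)))
            * sqrt (\<Sum>i=1..n. \<Sum>j=1..n. cmod (cinner (y i) (y j)))"
      using sum_squares_le_Max[OF bounds ne(2)] .
    show "(\<Sum>i=1..n. (cmod (cinner x (y i)))\<^sup>2)
        \<le> cinner_norm cinner x * (\<Sum>i=1..n. cmod (cinner x (y i)))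
            * (MAX (i, j)\<in>{1..n} \<times> {1..n}. sqrt (cmod (cinner (y i) (y j))))"
      using sum_squares_le_sum[OF bounds ne(2)] .
    fix p q :: real
    assume "p > 1 \<and> 1 / p + 1 / q = 1"
    then show "(\<Sum>i=1..n. (cmod (cinner x (y i)))\<^sup>2)
        \<le> cinner_norm cinner x * (\<Sum>i=1..n. cmod (cinner x (y i)) powr p) powr (1 / p)
            * (\<Sum>i=1..n. \<Sum>j=1..n. cmod (cinner (y i) (y j)) powr q) powr (1 / (2 * q))"
      using sum_squares_le_powr[OF bounds] by blast
  qed
qed

end
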